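(* Let $G$ be a connected semisimple Lie group with finite center and no compact factors, $\Gamma\le G$ an irreducible lattice, and $\{h_m\}_{m\in\mathbb Z}$ a discrete time one-parameter flow on $\mathcal X=\Gamma\backslash G$ coming from an unbounded one-parameter subgroup $\{h_t\}_{t\in\mathbb R}$ whose flow on $\Gamma\backslash G$ has summable decay (SD). Then the collection of spherical subsets of $\mathcal X$ is strongly Borel-Cantelli for $\{h_m\}_{m\in\mathbb Z}$; that is, for every sequence $\{B_m\}_{m\in\mathbb N}$ of measurable spherical subsets of $\mathcal X$ with $\sum_{m=1}^\infty\mu(B_m)=\infty$, for $\mu$-a.e. $x\in\mathcal X$ $$\lim_{m\to\infty}\frac{\#\{1\le j\le m: xh_j\in B_j\}}{\sum_{1\le j\le m}\mu(B_j)}=1 .$$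
   Context: $\mu$ is the $G$-invariant probability measure on $\mathcal X$; $K\le G$ is a fixed maximal compact subgroup; sets and functions on $\mathcal X$ are spherical if they are invariant under the right action of $K$. A one-parameter subgroup is $h_t=\exp(tX_0)$ with $X_0\in\mathrm{Lie}(G)$, acting on $\mathcal X$ by right multiplication; it is unbounded if it is not relatively compact in $G$. $\pi$ is the right regular representation on $L^2(\Gamma\backslash G)$ and $L^2_0(\Gamma\backslash G)$ the orthogonal complement of constants. The flow $\{h_t\}$ on $\Gamma\backslash G$ has summable decay (SD) if there are $\eta>1$ and $C>0$ such that $|\langle\pi(h_t)\varphi,\psi\rangle|\le C\|\varphi\|_2\|\psi\|_2|t|^{-\eta}$ for all spherical $\varphi,\psi\in L^2_0(\Gamma\backslash G)$ and all $|t|\ge1$. *)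

theory Defs
  imports
    "HOL-Probability.Probability"
    "HOL-Algebra.Coset"
    "HOL-Library.Function_Algebras"
begin

section \<open>Smooth maps between Euclidean spaces\<close>

text \<open>All iterated directional derivatives up to order \<open>k\<close> exist and are continuous.
  Only meaningful for open sets \<open>S\<close>.\<close>

primrec Ck_on :: "nat \<Rightarrow> 'a::real_normed_vector set \<Rightarrow> ('a \<Rightarrow> 'b::real_normed_vector) \<Rightarrow> bool" where
  "Ck_on 0 S f \<longleftrightarrow> continuous_on S f"
| "Ck_on (Suc k) S f \<longleftrightarrow>
     (\<forall>x\<in>S. f differentiable (at x)) \<and>
     (\<forall>v. Ck_on k S (\<lambda>x. frechet_derivative f (at x) v))"

definition smooth_on :: "'a::real_normed_vector set \<Rightarrow> ('a \<Rightarrow> 'b::real_normed_vector) \<Rightarrow> bool" where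
  "smooth_on S f \<longleftrightarrow> (\<forall>k. Ck_on k S f)"


section \<open>Lie groups\<close>

text \<open>A chart is a pair \<open>(U, c)\<close> of an open domain and a coordinate map. An atlas need not be
  maximal. The dimension is \<open>DIM('e)\<close>.\<close>

definition smooth_atlas :: "'g topology \<Rightarrow> ('g set \<times> ('g \<Rightarrow> 'e::euclidean_space)) set \<Rightarrow> bool" where
  "smooth_atlas T A \<longleftrightarrow>
     (\<forall>(U, c)\<in>A. openin T U \<and> open (c ` U) \<and>
        homeomorphic_map (subtopology T U) (top_of_set (c ` U)) c) \<and>
     \<Union> (fst ` A) = topspace T \<and>
     (\<forall>(U, c)\<in>A. \<forall>(V, d)\<in>A. smooth_on (c ` (U \<inter> V)) (d \<circ> inv_into U c))"

locale lie_group = group G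
  for G :: "'g monoid" (structure) +
  fixes T :: "'g topology"
    and A :: "('g set \<times> ('g \<Rightarrow> 'e::euclidean_space)) set"
  assumes topspace_eq: "topspace T = carrier G"
    and hausdorff: "Hausdorff_space T"
    and second_countable: "second_countable T"
    and atlas: "smooth_atlas T A"
    and continuous_mult: "continuous_map (prod_topology T T) T (\<lambda>(x, y). x \<otimes> y)"
    and continuous_inv: "continuous_map T T (\<lambda>x. inv x)"
    and smooth_mult:
      "\<And>U c V d W e. (U, c) \<in> A \<Longrightarrow> (V, d) \<in> A \<Longrightarrow> (W, e) \<in> A \<Longrightarrow>
         smooth_on {(c x, d y) | x y. x \<in> U \<and> y \<in> V \<and> x \<otimes> y \<in> W}
           (\<lambda>(p, q). e (inv_into U c p \<otimes> inv_into V d q))"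
    and smooth_inv:
      "\<And>U c W e. (U, c) \<in> A \<Longrightarrow> (W, e) \<in> A \<Longrightarrow>
         smooth_on {c x | x. x \<in> U \<and> inv x \<in> W} (\<lambda>p. e (inv (inv_into U c p)))"


section \<open>The Lie algebra\<close>

text \<open>Real functions on the group are normalised to be zero off the carrier, so that the pointwise
  operations on the function type turn \<open>smooth_functions G A\<close> into the algebra of smooth functions.\<close>

definition smooth_functions ::
    "'g monoid \<Rightarrow> ('g set \<times> ('g \<Rightarrow> 'e::euclidean_space)) set \<Rightarrow> ('g \<Rightarrow> real) set" where
  "smooth_functions G A =
     {f. (\<forall>x. x \<notin> carrier G \<longrightarrow> f x = 0) \<and>
         (\<forall>(U, c)\<in>A. smooth_on (c ` U) (f \<circ> inv_into U c))}"

definition left_translate :: "'g monoid \<Rightarrow> 'g \<Rightarrow> ('g \<Rightarrow> real) \<Rightarrow> 'g \<Rightarrow> real" where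
  "left_translate G g f = (\<lambda>x. if x \<in> carrier G then f (g \<otimes>\<^bsub>G\<^esub> x) else 0)"

text \<open>Left invariant vector fields, viewed as derivations of the algebra of smooth functions
  (and zero on all other functions). The bracket is the commutator.\<close>

type_synonym 'g vfield = "('g \<Rightarrow> real) \<Rightarrow> 'g \<Rightarrow> real"

definition lie_algebra ::
    "'g monoid \<Rightarrow> ('g set \<times> ('g \<Rightarrow> 'e::euclidean_space)) set \<Rightarrow> 'g vfield set" where
  "lie_algebra G A =
     {X. (\<forall>f. f \<notin> smooth_functions G A \<longrightarrow> X f = 0) \<and>
         (\<forall>f\<in>smooth_functions G A. X f \<in> smooth_functions G A) \<and>
         (\<forall>f\<in>smooth_functions G A. \<forall>g\<in>smooth_functions G A. X (f + g) = X f + X g) \<and>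
         (\<forall>r. \<forall>f\<in>smooth_functions G A. X (\<lambda>x. r * f x) = (\<lambda>x. r * X f x)) \<and>
         (\<forall>f\<in>smooth_functions G A. \<forall>g\<in>smooth_functions G A. X (f * g) = X f * g + f * X g) \<and>
         (\<forall>a\<in>carrier G. \<forall>f\<in>smooth_functions G A.
            X (left_translate G a f) = left_translate G a (X f))}"

definition vf_scale :: "real \<Rightarrow> 'g vfield \<Rightarrow> 'g vfield" where
  "vf_scale r X = (\<lambda>f x. r * X f x)"

lemma module_vf_scale: "module vf_scale"
  by unfold_locales (auto simp: vf_scale_def fun_eq_iff algebra_simps)

definition lie_bracket :: "'g vfield \<Rightarrow> 'g vfield \<Rightarrow> 'g vfield" where
  "lie_bracket X Y = (\<lambda>f. X (Y f) - Y (X f))"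

definition lie_ideal :: "'g vfield set \<Rightarrow> 'g vfield set \<Rightarrow> bool" where
  "lie_ideal L I \<longleftrightarrow> I \<subseteq> L \<and> module.subspace vf_scale I \<and> (\<forall>X\<in>L. \<forall>Y\<in>I. lie_bracket X Y \<in> I)"

primrec derived_series :: "nat \<Rightarrow> 'g vfield set \<Rightarrow> 'g vfield set" where
  "derived_series 0 L = L"
| "derived_series (Suc n) L =
     module.span vf_scale
       {lie_bracket X Y | X Y. X \<in> derived_series n L \<and> Y \<in> derived_series n L}"

definition lie_solvable :: "'g vfield set \<Rightarrow> bool" where
  "lie_solvable L \<longleftrightarrow> (\<exists>n. derived_series n L = {0})"

definition lie_semisimple :: "'g vfield set \<Rightarrow> bool" where
  "lie_semisimple L \<longleftrightarrow> (\<forall>I. lie_ideal L I \<and> lie_solvable I \<longrightarrow> I = {0})"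

text \<open>\<open>exp_curve G T A X h\<close> says that \<open>h t = exp (t X)\<close> for all \<open>t\<close>: by definition of the exponential
  map, \<open>t \<mapsto> exp (t X)\<close> is the one-parameter subgroup that is an integral curve of the left invariant
  vector field \<open>X\<close>.\<close>

definition exp_curve ::
    "'g monoid \<Rightarrow> 'g topology \<Rightarrow> ('g set \<times> ('g \<Rightarrow> 'e::euclidean_space)) set \<Rightarrow>
     'g vfield \<Rightarrow> (real \<Rightarrow> 'g) \<Rightarrow> bool" where
  "exp_curve G T A X h \<longleftrightarrow>
     continuous_map euclideanreal T h \<and>
     h 0 = \<one>\<^bsub>G\<^esub> \<and> (\<forall>s t. h (s + t) = h s \<otimes>\<^bsub>G\<^esub> h t) \<and>
     (\<forall>f\<in>smooth_functions G A. \<forall>t. ((\<lambda>s. f (h s)) has_real_derivative X f (h t)) (at t))"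

definition unbounded_in :: "'g topology \<Rightarrow> (real \<Rightarrow> 'g) \<Rightarrow> bool" where
  "unbounded_in T h \<longleftrightarrow> \<not> compactin T (T closure_of range h)"


section \<open>Structure of the group and its lattices\<close>

definition group_center :: "'g monoid \<Rightarrow> 'g set" where
  "group_center G = {z \<in> carrier G. \<forall>g\<in>carrier G. z \<otimes>\<^bsub>G\<^esub> g = g \<otimes>\<^bsub>G\<^esub> z}"

text \<open>The simple factors of a connected semisimple Lie group are its minimal nontrivial
  closed connected normal subgroups.\<close>

definition factor_subgroup :: "'g monoid \<Rightarrow> 'g topology \<Rightarrow> 'g set \<Rightarrow> bool" where
  "factor_subgroup G T N \<longleftrightarrow> N \<lhd> G \<and> closedin T N \<and> connectedin T N \<and> N \<noteq> {\<one>\<^bsub>G\<^esub>}"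

definition simple_factor :: "'g monoid \<Rightarrow> 'g topology \<Rightarrow> 'g set \<Rightarrow> bool" where
  "simple_factor G T N \<longleftrightarrow>
     factor_subgroup G T N \<and> (\<forall>M. factor_subgroup G T M \<and> M \<subseteq> N \<longrightarrow> M = N)"

definition no_compact_factors :: "'g monoid \<Rightarrow> 'g topology \<Rightarrow> bool" where
  "no_compact_factors G T \<longleftrightarrow> (\<forall>N. simple_factor G T N \<longrightarrow> \<not> compactin T N)"

definition compact_subgroup :: "'g monoid \<Rightarrow> 'g topology \<Rightarrow> 'g set \<Rightarrow> bool" where
  "compact_subgroup G T K \<longleftrightarrow> subgroup K G \<and> compactin T K"

definition maximal_compact_subgroup :: "'g monoid \<Rightarrow> 'g topology \<Rightarrow> 'g set \<Rightarrow> bool" where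
  "maximal_compact_subgroup G T K \<longleftrightarrow>
     compact_subgroup G T K \<and> (\<forall>K'. compact_subgroup G T K' \<and> K \<subseteq> K' \<longrightarrow> K' = K)"

text \<open>The space \<open>\<Gamma>\<setminus>G\<close> consists of the cosets \<open>\<Gamma> #> g\<close>, and \<open>g\<close> acts on the right by
  \<open>x \<mapsto> x #> g\<close>.\<close>

definition coset_topology :: "'g monoid \<Rightarrow> 'g topology \<Rightarrow> 'g set \<Rightarrow> 'g set topology" where
  "coset_topology G T \<Gamma> =
     topology (\<lambda>U. U \<subseteq> rcosets\<^bsub>G\<^esub> \<Gamma> \<and> openin T {g \<in> topspace T. \<Gamma> #>\<^bsub>G\<^esub> g \<in> U})"

lemma openin_coset_topology:
  "openin (coset_topology G T \<Gamma>) U \<longleftrightarrow>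
     U \<subseteq> rcosets\<^bsub>G\<^esub> \<Gamma> \<and> openin T {g \<in> topspace T. \<Gamma> #>\<^bsub>G\<^esub> g \<in> U}"
proof -
  have "istopology (\<lambda>U. U \<subseteq> rcosets\<^bsub>G\<^esub> \<Gamma> \<and> openin T {g \<in> topspace T. \<Gamma> #>\<^bsub>G\<^esub> g \<in> U})"
    unfolding istopology_def
  proof (intro conjI allI impI; (elim conjE)?)
    fix S U
    assume "openin T {g \<in> topspace T. \<Gamma> #>\<^bsub>G\<^esub> g \<in> S}" "openin T {g \<in> topspace T. \<Gamma> #>\<^bsub>G\<^esub> g \<in> U}"
    then have "openin T ({g \<in> topspace T. \<Gamma> #>\<^bsub>G\<^esub> g \<in> S} \<inter> {g \<in> topspace T. \<Gamma> #>\<^bsub>G\<^esub> g \<in> U})"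
      by blast
    then show "openin T {g \<in> topspace T. \<Gamma> #>\<^bsub>G\<^esub> g \<in> S \<inter> U}"
      by (rule back_subst[where P = "openin T"]) auto
  next
    fix \<K>
    assume "\<forall>U\<in>\<K>. U \<subseteq> rcosets\<^bsub>G\<^esub> \<Gamma> \<and> openin T {g \<in> topspace T. \<Gamma> #>\<^bsub>G\<^esub> g \<in> U}"
    then have "openin T (\<Union>U\<in>\<K>. {g \<in> topspace T. \<Gamma> #>\<^bsub>G\<^esub> g \<in> U})"
      by blast
    then show "openin T {g \<in> topspace T. \<Gamma> #>\<^bsub>G\<^esub> g \<in> \<Union>\<K>}"
      by (rule back_subst[where P = "openin T"]) auto
  qed blast+
  then show ?thesis
    by (simp add: coset_topology_def)
qed

lemma (in lie_group) quotient_map_coset_topology: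
  "quotient_map T (coset_topology G T \<Gamma>) (\<lambda>g. \<Gamma> #> g)"
proof -
  have "{g \<in> topspace T. \<Gamma> #> g \<in> rcosets \<Gamma>} = topspace T"
    by (auto simp: topspace_eq RCOSETS_def)
  then have "openin (coset_topology G T \<Gamma>) (rcosets \<Gamma>)"
    by (simp add: openin_coset_topology)
  then have "topspace (coset_topology G T \<Gamma>) = rcosets \<Gamma>"
    by (meson openin_coset_topology openin_subset openin_topspace subset_antisym)
  then show ?thesis
    by (auto simp: quotient_map_def openin_coset_topology topspace_eq RCOSETS_def)
qed

definition invariant_prob :: "'g monoid \<Rightarrow> 'g topology \<Rightarrow> 'g set \<Rightarrow> 'g set measure \<Rightarrow> bool" where
  "invariant_prob G T \<Gamma> \<mu> \<longleftrightarrow>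
     prob_space \<mu> \<and>
     sets \<mu> = sets (sigma (rcosets\<^bsub>G\<^esub> \<Gamma>) {U. openin (coset_topology G T \<Gamma>) U}) \<and>
     (\<forall>g\<in>carrier G. distr \<mu> \<mu> (\<lambda>x. x #>\<^bsub>G\<^esub> g) = \<mu>)"

definition lattice_in :: "'g monoid \<Rightarrow> 'g topology \<Rightarrow> 'g set \<Rightarrow> bool" where
  "lattice_in G T \<Gamma> \<longleftrightarrow>
     subgroup \<Gamma> G \<and> subtopology T \<Gamma> = discrete_topology \<Gamma> \<and> (\<exists>\<mu>. invariant_prob G T \<Gamma> \<mu>)"

text \<open>Irreducibility: for every noncompact closed normal subgroup \<open>N\<close>, the image of \<open>\<Gamma>\<close> in
  \<open>G/N\<close> is dense.\<close>

definition irreducible_lattice :: "'g monoid \<Rightarrow> 'g topology \<Rightarrow> 'g set \<Rightarrow> bool" where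
  "irreducible_lattice G T \<Gamma> \<longleftrightarrow>
     lattice_in G T \<Gamma> \<and>
     (\<forall>N. N \<lhd> G \<and> closedin T N \<and> \<not> compactin T N \<longrightarrow>
        T closure_of (\<Gamma> <#>\<^bsub>G\<^esub> N) = carrier G)"


section \<open>Spherical functions, summable decay, and the Borel-Cantelli property\<close>

definition spherical_set :: "'g monoid \<Rightarrow> 'g set \<Rightarrow> 'g set set \<Rightarrow> bool" where
  "spherical_set G K B \<longleftrightarrow> (\<forall>k\<in>K. (\<lambda>x. x #>\<^bsub>G\<^esub> k) ` B = B)"

definition spherical_fun :: "'g monoid \<Rightarrow> 'g set \<Rightarrow> 'g set \<Rightarrow> ('g set \<Rightarrow> complex) \<Rightarrow> bool" where
  "spherical_fun G \<Gamma> K \<phi> \<longleftrightarrow> (\<forall>x\<in>rcosets\<^bsub>G\<^esub> \<Gamma>. \<forall>k\<in>K. \<phi> (x #>\<^bsub>G\<^esub> k) = \<phi> x)"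

definition L2_zero :: "'x measure \<Rightarrow> ('x \<Rightarrow> complex) set" where
  "L2_zero \<mu> = {\<phi> \<in> borel_measurable \<mu>. integrable \<mu> (\<lambda>x. (cmod (\<phi> x))\<^sup>2) \<and> (LINT x|\<mu>. \<phi> x) = 0}"

definition L2_norm :: "'x measure \<Rightarrow> ('x \<Rightarrow> complex) \<Rightarrow> real" where
  "L2_norm \<mu> \<phi> = sqrt (LINT x|\<mu>. (cmod (\<phi> x))\<^sup>2)"

definition L2_inner :: "'x measure \<Rightarrow> ('x \<Rightarrow> complex) \<Rightarrow> ('x \<Rightarrow> complex) \<Rightarrow> complex" where
  "L2_inner \<mu> \<phi> \<psi> = (LINT x|\<mu>. \<phi> x * cnj (\<psi> x))"

definition right_regular :: "'g monoid \<Rightarrow> 'g \<Rightarrow> ('g set \<Rightarrow> complex) \<Rightarrow> 'g set \<Rightarrow> complex" where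
  "right_regular G g \<phi> = (\<lambda>x. \<phi> (x #>\<^bsub>G\<^esub> g))"

definition summable_decay ::
    "'g monoid \<Rightarrow> 'g set \<Rightarrow> 'g set \<Rightarrow> 'g set measure \<Rightarrow> (real \<Rightarrow> 'g) \<Rightarrow> bool" where
  "summable_decay G \<Gamma> K \<mu> h \<longleftrightarrow>
     (\<exists>\<eta> C. \<eta> > 1 \<and> C > 0 \<and>
        (\<forall>\<phi>\<in>L2_zero \<mu>. \<forall>\<psi>\<in>L2_zero \<mu>. spherical_fun G \<Gamma> K \<phi> \<longrightarrow> spherical_fun G \<Gamma> K \<psi> \<longrightarrow>
           (\<forall>t. \<bar>t\<bar> \<ge> 1 \<longrightarrow>
              cmod (L2_inner \<mu> (right_regular G (h t) \<phi>) \<psi>)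
                \<le> C * L2_norm \<mu> \<phi> * L2_norm \<mu> \<psi> * \<bar>t\<bar> powr (- \<eta>))))"

definition strongly_borel_cantelli ::
    "'x measure \<Rightarrow> (int \<Rightarrow> 'x \<Rightarrow> 'x) \<Rightarrow> 'x set set \<Rightarrow> bool" where
  "strongly_borel_cantelli \<mu> \<tau> \<C> \<longleftrightarrow>
     (\<forall>B :: nat \<Rightarrow> 'x set.
        (\<forall>m\<ge>1. B m \<in> \<C> \<and> B m \<in> sets \<mu>) \<longrightarrow>
        filterlim (\<lambda>m. \<Sum>j=1..m. measure \<mu> (B j)) at_top sequentially \<longrightarrow>
        (AE x in \<mu>.
           (\<lambda>m. real (card {j\<in>{1..m}. \<tau> (int j) x \<in> B j}) / (\<Sum>j=1..m. measure \<mu> (B j)))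
             \<longlonglongrightarrow> 1))"

end

theory Submission
  imports Defs "HOL-Real_Asymp.Real_Asymp"
begin

text \<open>
  Put \<open>A\<^sub>j = {x. x h\<^sub>j \<in> B\<^sub>j}\<close>. Summable decay, applied to the centred indicators of the sets
  \<open>B\<^sub>j\<close>, bounds the covariance of \<open>A\<^sub>i\<close> and \<open>A\<^sub>j\<close> by \<open>C \<bar>i - j\<bar>\<^sup>-\<^sup>\<eta> sqrt (\<mu>(B\<^sub>i) \<mu>(B\<^sub>j))\<close>. As \<open>\<eta> > 1\<close>,
  the variance of the counting function \<open>S\<^sub>m\<close> is at most a constant times its mean \<open>E\<^sub>m\<close>. Along a
  subsequence with \<open>E\<close> close to \<open>k\<^sup>2\<close>, the second moments of \<open>S / E - 1\<close> are summable, so \<open>S / E\<close> tends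
  to \<open>1\<close> almost surely there. Monotonicity of \<open>S\<close> fills the gaps between consecutive squares.
\<close>

section \<open>Real sequences, almost sure convergence and sums over distances\<close>

text \<open>The hypothesis \<open>n\<close> says that \<open>n k\<close> is the first index at which \<open>e\<close> reaches \<open>k\<^sup>2\<close>.\<close>

lemma ratio_tendsto_one_if_squares:
  fixes u e :: "nat \<Rightarrow> real"
  assumes u: "incseq u" "\<And>m. 0 \<le> u m"
    and n: "\<And>k m. (real k)\<^sup>2 \<le> e m \<longleftrightarrow> n k \<le> m"
    and upper: "\<And>k. e (n k) \<le> (real k)\<^sup>2 + 1"
    and inf: "filterlim e at_top sequentially"
    and sub: "(\<lambda>k. u (n k) / e (n k)) \<longlonglongrightarrow> 1"
  shows "(\<lambda>m. u m / e m) \<longlonglongrightarrow> 1"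
proof -
  define r where "r = (\<lambda>k. u (n k) / e (n k))"
  \<comment> \<open>\<open>k m\<close> indexes the block of \<open>m\<close>: it will turn out that
    \<open>n (k m) \<le> m \<le> n (Suc (k m))\<close>.\<close>
  define k where "k = (\<lambda>m. nat \<lfloor>sqrt (e m)\<rfloor>)"
  have lower: "(real k)\<^sup>2 \<le> e (n k)" for k
    by (simp add: n)
  have klim: "filterlim k at_top sequentially"
  proof -
    have "filterlim (\<lambda>x::real. nat \<lfloor>sqrt x\<rfloor>) at_top at_top"
      by real_asymp
    then show ?thesis
      unfolding k_def by (rule filterlim_compose) (rule inf)
  qed
  have r: "r \<longlonglongrightarrow> 1"
    using sub by (simp add: r_def)
  \<comment> \<open>The sandwiching sequences: within a block, replacing \<open>e m\<close> by the
    values at the ends costs a factor tending to 1.\<close>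
  have "(\<lambda>j. (real j)\<^sup>2 / (real j + 1)\<^sup>2) \<longlonglongrightarrow> 1"
    by real_asymp
  from tendsto_mult[OF r this]
  have lo: "(\<lambda>j. r j * ((real j)\<^sup>2 / (real j + 1)\<^sup>2)) \<longlonglongrightarrow> 1"
    by simp
  have "(\<lambda>j. ((real j + 1)\<^sup>2 + 1) / (real j)\<^sup>2) \<longlonglongrightarrow> 1"
    by real_asymp
  from tendsto_mult[OF LIMSEQ_Suc[OF r] this]
  have hi: "(\<lambda>j. r (Suc j) * (((real j + 1)\<^sup>2 + 1) / (real j)\<^sup>2)) \<longlonglongrightarrow> 1"
    by simp
  \<comment> \<open>The restriction \<open>1 < e m\<close> forces \<open>k m \<ge> 1\<close>, so no
    denominator vanishes.\<close>
  have bounds: "r (k m) * ((real (k m))\<^sup>2 / (real (k m) + 1)\<^sup>2) \<le> u m / e m \<and>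
      u m / e m \<le> r (Suc (k m)) * (((real (k m) + 1)\<^sup>2 + 1) / (real (k m))\<^sup>2)"
    if m: "1 < e m" for m
  proof -
    define j where "j = k m"
    have "1 \<le> sqrt (e m)"
      using m by simp
    then have j: "real j \<le> sqrt (e m)" "sqrt (e m) < real j + 1" "1 \<le> j"
      unfolding j_def k_def by linarith+
    have em_ge: "(real j)\<^sup>2 \<le> e m"
      using j(1) m power_mono[of "real j" "sqrt (e m)" 2] by simp
    have em_less: "e m < (real j + 1)\<^sup>2"
      using j(2) m power_strict_mono[of "sqrt (e m)" "real j + 1" 2] by simp
    have "n j \<le> m"
      using em_ge by (simp add: n)
    then have u_ge: "u (n j) \<le> u m"
      using u(1) by (simp add: incseqD)
    \<comment> \<open>The negated form of \<open>n\<close> places \<open>m\<close> strictly before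
      the next square is reached.\<close>
    have "\<not> (real (Suc j))\<^sup>2 \<le> e m"
      using em_less by (simp add: add.commute)
    then have "m \<le> n (Suc j)"
      unfolding n by simp
    then have u_le: "u m \<le> u (n (Suc j))"
      using u(1) by (simp add: incseqD)
    have j_pos: "0 < (real j)\<^sup>2"
      using j(3) by simp
    have e_pos: "0 < e (n j)" "0 < e (n (Suc j))"
      using less_le_trans[OF _ lower[of j]] less_le_trans[OF _ lower[of "Suc j"]] j(3) by simp_all
    have "r j * (real j)\<^sup>2 \<le> u (n j)"
      using mult_left_mono[OF lower[of j] u(2)[of "n j"]] e_pos(1) by (simp add: r_def field_simps)
    then have "r j * (real j)\<^sup>2 / (real j + 1)\<^sup>2 \<le> u m / e m"
      using u_ge u(2) m em_less by (intro frac_le) auto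
    \<comment> \<open>The extra 1 is the overshoot past the square that \<open>upper\<close>
      permits.\<close>
    moreover have "u (n (Suc j)) \<le> r (Suc j) * ((real j + 1)\<^sup>2 + 1)"
    proof -
      have "u (n (Suc j)) = r (Suc j) * e (n (Suc j))"
        using e_pos(2) by (simp add: r_def)
      also have "\<dots> \<le> r (Suc j) * ((real j + 1)\<^sup>2 + 1)"
        using upper[of "Suc j"] u(2)[of "n (Suc j)"] e_pos(2)
        by (intro mult_left_mono) (auto simp: r_def add.commute)
      finally show ?thesis .
    qed
    then have "u m / e m \<le> r (Suc j) * ((real j + 1)\<^sup>2 + 1) / (real j)\<^sup>2"
      using u_le u(2)[of m] em_ge j_pos by (intro frac_le) auto
    ultimately show ?thesis
      by (simp add: j_def)
  qed
  have "\<forall>\<^sub>F m in sequentially. 1 < e m"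
    using inf by (simp add: filterlim_at_top_dense)
  then show ?thesis
    using bounds
    by (intro tendsto_sandwich[OF _ _ filterlim_compose[OF lo klim] filterlim_compose[OF hi klim]])
      (auto elim: eventually_mono)
qed

text \<open>Interchanging sum and integral gives the series a finite integral, so it converges
  almost everywhere and its terms tend to 0.\<close>

lemma AE_tendsto_zero_if_summable_integral:
  fixes f :: "nat \<Rightarrow> 'a \<Rightarrow> real"
  assumes int: "\<And>k. integrable M (f k)" and nonneg: "\<And>k x. 0 \<le> f k x"
    and sum: "summable (\<lambda>k. LINT x|M. f k x)"
  shows "AE x in M. (\<lambda>k. f k x) \<longlonglongrightarrow> 0"
proof -
  have [measurable]: "f k \<in> borel_measurable M" for k
    using int by auto
  have "(\<integral>\<^sup>+x. (\<Sum>k. ennreal (f k x)) \<partial>M) = (\<Sum>k. \<integral>\<^sup>+x. ennreal (f k x) \<partial>M)"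
    by (intro nn_integral_suminf) auto
  also have "\<dots> = (\<Sum>k. ennreal (LINT x|M. f k x))"
    by (simp add: nn_integral_eq_integral[OF int] nonneg)
  also have "\<dots> = ennreal (\<Sum>k. LINT x|M. f k x)"
    by (intro suminf_ennreal2 sum Bochner_Integration.integral_nonneg nonneg)
  also have "\<dots> \<noteq> \<infinity>"
    by simp
  finally have "AE x in M. (\<Sum>k. ennreal (f k x)) \<noteq> \<infinity>"
    by (intro nn_integral_PInf_AE) auto
  then show ?thesis
    by eventually_elim (auto intro!: summable_LIMSEQ_zero summable_suminf_not_top nonneg)
qed

text \<open>Each distance from \<open>i\<close> occurs at most twice, once on either side. The bound
  is uniform in \<open>i\<close> and \<open>n\<close>.\<close>

lemma sum_dist_le_suminf:
  fixes c :: "nat \<Rightarrow> real"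
  assumes "\<And>d. 0 \<le> c d" "summable c"
  shows "(\<Sum>j=1..n. c (nat \<bar>int i - int j\<bar>)) \<le> 2 * suminf c"
proof -
  \<comment> \<open>The range is enlarged so that each side of \<open>i\<close> becomes an initial
    piece of the series under a simple reindexing.\<close>
  have "(\<Sum>j=1..n. c (nat \<bar>int i - int j\<bar>)) \<le>
      (\<Sum>j\<in>{..i} \<union> {i<..i+n}. c (nat \<bar>int i - int j\<bar>))"
    using assms(1) by (intro sum_mono2) auto
  also have "\<dots> = (\<Sum>j\<in>{..i}. c (nat \<bar>int i - int j\<bar>)) + (\<Sum>j\<in>{i<..i+n}. c (nat \<bar>int i - int j\<bar>))"
    by (intro sum.union_disjoint) auto
  also have "(\<Sum>j\<in>{..i}. c (nat \<bar>int i - int j\<bar>)) = sum c {..i}"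
    by (rule sum.reindex_bij_witness[of _ "\<lambda>d. i - d" "\<lambda>j. i - j"]) (auto simp: nat_diff_distrib')
  also have "(\<Sum>j\<in>{i<..i+n}. c (nat \<bar>int i - int j\<bar>)) = sum c {1..n}"
    by (rule sum.reindex_bij_witness[of _ "\<lambda>d. i + d" "\<lambda>j. j - i"]) (auto simp: nat_diff_distrib')
  also have "sum c {..i} + sum c {1..n} \<le> suminf c + suminf c"
    using assms by (intro add_mono sum_le_suminf) auto
  finally show ?thesis
    by simp
qed

section \<open>The second moment method for counting functions\<close>

context prob_space
begin

text \<open>The variance is the double sum of the covariances. By symmetry in \<open>i\<close> and
  \<open>j\<close> the bound splits into two equal sums, and summing over the free index first costs
  \<open>2 * suminf c\<close> in each.\<close>

lemma variance_count_le:
  fixes A :: "nat \<Rightarrow> 'a set" and c :: "nat \<Rightarrow> real"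
  assumes A: "\<And>j. j \<ge> 1 \<Longrightarrow> A j \<in> events"
    and c: "\<And>d. 0 \<le> c d" "summable c"
    and cov: "\<And>i j. i \<ge> 1 \<Longrightarrow> j \<ge> 1 \<Longrightarrow> prob (A i \<inter> A j) - prob (A i) * prob (A j)
      \<le> c (nat \<bar>int i - int j\<bar>) * (prob (A i) + prob (A j))"
  shows "variance (\<lambda>x. \<Sum>j=1..n. indicator (A j) x) \<le> 4 * suminf c * (\<Sum>j=1..n. prob (A j))"
proof -
  define S where "S = (\<lambda>x. \<Sum>j=1..n. indicator (A j) x :: real)"
  define p where "p = (\<lambda>j. prob (A j))"
  define d where "d = (\<lambda>i j. c (nat \<bar>int i - int j\<bar>))"
  have square: "(\<lambda>x. (S x)\<^sup>2) = (\<lambda>x. \<Sum>i=1..n. \<Sum>j=1..n. indicator (A i \<inter> A j) x)"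
    by (simp add: S_def power2_eq_square sum_product indicator_inter_arith)
  have int: "integrable M S" "integrable M (\<lambda>x. (S x)\<^sup>2)"
    unfolding square unfolding S_def using A
    by (auto intro!: Bochner_Integration.integrable_sum simp: emeasure_eq_measure)
  have ES: "expectation S = (\<Sum>j=1..n. p j)"
    unfolding S_def p_def using A
    by (subst Bochner_Integration.integral_sum) (auto simp: emeasure_eq_measure)
  have ES2: "expectation (\<lambda>x. (S x)\<^sup>2) = (\<Sum>i=1..n. \<Sum>j=1..n. prob (A i \<inter> A j))"
    unfolding square using A
    by (subst Bochner_Integration.integral_sum
        | auto simp: emeasure_eq_measure intro!: sum.cong Bochner_Integration.integrable_sum)+
  have half: "(\<Sum>i=1..n. \<Sum>j=1..n. d i j * p i) \<le> 2 * suminf c * (\<Sum>i=1..n. p i)"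
  proof -
    have "(\<Sum>i=1..n. \<Sum>j=1..n. d i j * p i) = (\<Sum>i=1..n. (\<Sum>j=1..n. d i j) * p i)"
      by (simp add: sum_distrib_right)
    also have "\<dots> \<le> (\<Sum>i=1..n. 2 * suminf c * p i)"
      unfolding d_def p_def using sum_dist_le_suminf[OF c] by (intro sum_mono mult_right_mono) auto
    finally show ?thesis
      by (simp add: sum_distrib_left)
  qed
  have "variance S = expectation (\<lambda>x. (S x)\<^sup>2) - (expectation S)\<^sup>2"
    by (rule variance_eq[OF int])
  also have "\<dots> = (\<Sum>i=1..n. \<Sum>j=1..n. prob (A i \<inter> A j) - p i * p j)"
    unfolding ES ES2 by (simp add: power2_eq_square sum_product sum_subtractf)
  also have "\<dots> \<le> (\<Sum>i=1..n. \<Sum>j=1..n. d i j * (p i + p j))"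
    unfolding p_def d_def by (intro sum_mono cov) auto
  also have "\<dots> = (\<Sum>i=1..n. \<Sum>j=1..n. d i j * p i) + (\<Sum>i=1..n. \<Sum>j=1..n. d i j * p j)"
    by (simp add: distrib_left sum.distrib)
  \<comment> \<open>Swapping the sums and using that \<open>d\<close> is symmetric reduces this half
    to \<open>half\<close>.\<close>
  also have "(\<Sum>i=1..n. \<Sum>j=1..n. d i j * p j) = (\<Sum>j=1..n. \<Sum>i=1..n. d j i * p j)"
    by (subst sum.swap) (simp add: d_def abs_minus_commute)
  finally show ?thesis
    using half by (simp add: S_def p_def)
qed

text \<open>The second moment of the relative error is at most \<open>D\<close> divided by the mean,
  hence summable along indices where the mean is at least the \<open>k\<close>-th square.\<close>

lemma AE_count_ratio_tendsto_one:
  fixes A :: "nat \<Rightarrow> 'a set"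
  assumes A: "\<And>j. j \<ge> 1 \<Longrightarrow> A j \<in> events"
    and var: "\<And>n. variance (\<lambda>x. \<Sum>j=1..n. indicator (A j) x) \<le> D * (\<Sum>j=1..n. prob (A j))"
    and inf: "filterlim (\<lambda>n. \<Sum>j=1..n. prob (A j)) at_top sequentially"
  shows "AE x in M. (\<lambda>n. (\<Sum>j=1..n. indicator (A j) x) / (\<Sum>j=1..n. prob (A j))) \<longlonglongrightarrow> 1"
proof -
  define S where "S = (\<lambda>n x. \<Sum>j=1..n. indicator (A j) x :: real)"
  define e where "e = (\<lambda>n. \<Sum>j=1..n. prob (A j))"
  define n where "n = (\<lambda>k. LEAST m. (real k)\<^sup>2 \<le> e m)"
  have e_inf: "filterlim e at_top sequentially"
    using inf by (simp add: e_def)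
  have "incseq e"
    unfolding e_def by (auto intro!: incseq_SucI)
  have ex: "\<exists>m. (real k)\<^sup>2 \<le> e m" for k
    using e_inf unfolding filterlim_at_top eventually_sequentially by blast
  have n_le: "(real k)\<^sup>2 \<le> e (n k)" for k
    unfolding n_def by (rule LeastI_ex) (rule ex)
  have n: "(real k)\<^sup>2 \<le> e m \<longleftrightarrow> n k \<le> m" for k m
    using n_le[of k] \<open>incseq e\<close> by (auto simp: n_def intro: Least_le dest: incseqD order_trans)
  \<comment> \<open>One step raises \<open>e\<close> by a probability, so the first passage
    overshoots by at most 1; if it happens at index 0, then \<open>e\<close> is 0 there.\<close>
  have upper: "e (n k) \<le> (real k)\<^sup>2 + 1" for k
  proof (cases "n k")
    case 0
    then show ?thesis by (simp add: e_def)
  next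
    case (Suc m)
    then have "\<not> (real k)\<^sup>2 \<le> e m"
      by (simp add: n)
    moreover have "e (Suc m) \<le> e m + 1"
      by (simp add: e_def)
    ultimately show ?thesis
      using Suc by simp
  qed
  have S_bounds: "0 \<le> S m x" "S m x \<le> real m" for m x
    using sum_bounded_above[of "{1..m}" "\<lambda>j. indicator (A j) x :: real" 1]
    by (auto simp: S_def sum_nonneg)
  have [measurable]: "S m \<in> borel_measurable M" for m
    unfolding S_def using A by auto
  have ES: "expectation (S m) = e m" for m
    unfolding S_def e_def using A
    by (subst Bochner_Integration.integral_sum) (auto simp: emeasure_eq_measure)
  define f where "f = (\<lambda>k x. (S (n k) x / e (n k) - 1)\<^sup>2)"
  have f_int: "integrable M (f k)" for k
  proof -
    have int: "integrable M (S m)" for m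
      using S_bounds by (intro integrable_const_bound[of _ "real m"]) auto
    have "integrable M (\<lambda>x. (S m x)\<^sup>2)" for m
      using S_bounds by (intro integrable_const_bound[of _ "(real m)\<^sup>2"]) (auto simp: power_mono)
    with int show ?thesis
      by (auto simp: f_def power2_diff power_divide)
  qed
  \<comment> \<open>The sign of \<open>D\<close> follows from a nonnegative variance at
    \<open>n 1\<close>, where the mean is at least 1.\<close>
  have "0 \<le> D"
  proof -
    have "0 \<le> variance (S (n 1))"
      by simp
    also have "\<dots> \<le> D * e (n 1)"
      using var[of "n 1"] by (simp add: S_def e_def)
    finally show ?thesis
      using n_le[of 1] by (simp add: zero_le_mult_iff)
  qed
  \<comment> \<open>The case \<open>k = 0\<close> is left out because \<open>e (n 0)\<close> is
    0.\<close>
  have Ef: "expectation (f k) \<le> D * inverse ((real k)\<^sup>2)" if "k \<ge> 1" for k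
  proof -
    have pos: "0 < e (n k)"
      using n_le[of k] that by (auto intro: less_le_trans[rotated])
    have "f k = (\<lambda>x. (S (n k) x - expectation (S (n k)))\<^sup>2 / (e (n k))\<^sup>2)"
      unfolding f_def ES using pos by (simp add: fun_eq_iff power_divide[symmetric] diff_divide_distrib)
    then have "expectation (f k) = variance (S (n k)) / (e (n k))\<^sup>2"
      by simp
    also have "\<dots> \<le> D * e (n k) / (e (n k))\<^sup>2"
      using var[of "n k"] by (intro divide_right_mono) (simp_all add: S_def e_def)
    also have "\<dots> = D * inverse (e (n k))"
      using pos by (simp add: power2_eq_square field_simps)
    also have "\<dots> \<le> D * inverse ((real k)\<^sup>2)"
      using n_le[of k] that \<open>0 \<le> D\<close> by (intro mult_left_mono le_imp_inverse_le) auto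
    finally show ?thesis .
  qed
  have "summable (\<lambda>k. expectation (f k))"
  proof (rule summable_comparison_test_ev)
    show "summable (\<lambda>k. D * inverse ((real k)\<^sup>2))"
      using inverse_power_summable[of 2, where ?'a = real] by (intro summable_mult) simp
    show "\<forall>\<^sub>F k in sequentially. norm (expectation (f k)) \<le> D * inverse ((real k)\<^sup>2)"
      using eventually_ge_at_top[of 1]
      by eventually_elim (use Ef in \<open>auto simp: f_def\<close>)
  qed
  then have "AE x in M. (\<lambda>k. f k x) \<longlonglongrightarrow> 0"
    using f_int by (intro AE_tendsto_zero_if_summable_integral) (auto simp: f_def)
  then show ?thesis
  proof eventually_elim
    case (elim x)
    \<comment> \<open>The square root of \<open>f k x\<close> is the absolute value of the relative
      error.\<close>
    from tendsto_real_sqrt[OF this] have "(\<lambda>k. S (n k) x / e (n k) - 1) \<longlonglongrightarrow> 0"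
      by (simp add: f_def tendsto_rabs_zero_iff)
    then have "(\<lambda>k. S (n k) x / e (n k)) \<longlonglongrightarrow> 1"
      by (simp add: LIM_zero_iff)
    moreover have "incseq (\<lambda>m. S m x)"
      unfolding S_def by (auto intro!: incseq_SucI)
    ultimately show ?case
      using ratio_tendsto_one_if_squares[of "\<lambda>m. S m x" e n] S_bounds n upper e_inf
      by (simp add: S_def e_def)
  qed
qed

section \<open>Centred indicators as mean-zero square-integrable functions\<close>

lemma expectation_centred_indicators:
  assumes "A \<in> events" "B \<in> events"
  shows "expectation (\<lambda>x. (indicator A x - prob A) * (indicator B x - prob B)) =
    prob (A \<inter> B) - prob A * prob B"
proof -
  have "(\<lambda>x. (indicator A x - prob A) * (indicator B x - prob B)) =
      (\<lambda>x. indicator (A \<inter> B) x - prob B * indicator A x - prob A * indicator B x + prob A * prob B)"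
    by (simp add: fun_eq_iff algebra_simps indicator_inter_arith)
  then show ?thesis
    using assms by (simp add: emeasure_eq_measure prob_space)
qed

text \<open>Complex-valued, since \<open>L2_zero\<close> and \<open>summable_decay\<close> are
  stated for complex functions.\<close>

definition centred :: "'a set \<Rightarrow> 'a \<Rightarrow> complex" where
  "centred A x = of_real (indicator A x - prob A)"

lemma centred_L2_zero:
  assumes "A \<in> events"
  shows "centred A \<in> L2_zero M"
proof -
  have [measurable]: "A \<in> events" by fact
  have "cmod (centred A x) \<le> 1" for x
    using prob_le_1[of A] by (auto simp: centred_def indicator_def simp flip: of_real_diff)
  then have "integrable M (\<lambda>x. (cmod (centred A x))\<^sup>2)"
    by (intro integrable_const_bound[of _ 1]) (auto simp: power_le_one centred_def)
  moreover have "(LINT x|M. centred A x) = 0"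
    unfolding centred_def by (subst integral_complex_of_real)
      (simp add: emeasure_eq_measure prob_space)
  ultimately show ?thesis
    by (simp add: L2_zero_def centred_def[abs_def])
qed

text \<open>Through this identity, decay of matrix coefficients becomes decay of
  covariances.\<close>

lemma L2_inner_centred:
  assumes "A \<in> events" "B \<in> events"
  shows "L2_inner M (centred A) (centred B) = of_real (prob (A \<inter> B) - prob A * prob B)"
  unfolding L2_inner_def centred_def expectation_centred_indicators[OF assms, symmetric]
  by (simp flip: of_real_mult of_real_diff integral_complex_of_real)

text \<open>The squared norm is the variance \<open>prob A - prob A * prob A\<close>.\<close>

lemma L2_norm_centred_le:
  assumes "A \<in> events"
  shows "L2_norm M (centred A) \<le> sqrt (prob A)"
proof -
  have "(cmod (centred A x))\<^sup>2 = (indicator A x - prob A) * (indicator A x - prob A)" for x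
    by (simp add: centred_def power2_eq_square flip: of_real_diff)
  then show ?thesis
    using expectation_centred_indicators[OF assms assms] by (simp add: L2_norm_def)
qed

end

section \<open>Right translations on the coset space\<close>

text \<open>It suffices to test open sets. Pulled back to the group, the preimage of an open set is
  its preimage under the continuous map \<open>a \<otimes> g\<close>, hence open.\<close>

lemma (in lie_group) measurable_right_translation:
  assumes \<Gamma>: "\<Gamma> \<subseteq> carrier G" and g: "g \<in> carrier G"
    and sets: "sets \<mu> = sets (sigma (rcosets \<Gamma>) {U. openin (coset_topology G T \<Gamma>) U})"
  shows "(\<lambda>x. x #> g) \<in> measurable \<mu> \<mu>"
proof -
  define \<O> where "\<O> = {U. openin (coset_topology G T \<Gamma>) U}"
  have O: "\<O> \<subseteq> Pow (rcosets \<Gamma>)"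
    by (auto simp: \<O>_def openin_coset_topology)
  have closed: "x #> g \<in> rcosets \<Gamma>" if "x \<in> rcosets \<Gamma>" for x
    using that g \<Gamma> by (auto simp: RCOSETS_def coset_mult_assoc)
  have "continuous_map T T (\<lambda>a. a \<otimes> g)"
    using continuous_map_compose[OF _ continuous_mult, of T "\<lambda>a. (a, g)"] g
    by (simp add: o_def continuous_map_paired topspace_eq)
  then have "openin T {a \<in> topspace T. a \<otimes> g \<in> {b \<in> topspace T. \<Gamma> #> b \<in> U}}" if "U \<in> \<O>" for U
    using that by (auto simp: \<O>_def openin_coset_topology dest: openin_continuous_map_preimage)
  moreover have "{a \<in> topspace T. \<Gamma> #> a \<in> (\<lambda>x. x #> g) -` U \<inter> rcosets \<Gamma>} =
      {a \<in> topspace T. a \<otimes> g \<in> {b \<in> topspace T. \<Gamma> #> b \<in> U}}" for U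
    using g \<Gamma> by (auto simp: topspace_eq coset_mult_assoc RCOSETS_def)
  ultimately have "(\<lambda>x. x #> g) -` U \<inter> rcosets \<Gamma> \<in> \<O>" if "U \<in> \<O>" for U
    using that by (simp add: \<O>_def openin_coset_topology)
  then have "(\<lambda>x. x #> g) \<in> measurable (sigma (rcosets \<Gamma>) \<O>) (sigma (rcosets \<Gamma>) \<O>)"
    using closed O by (intro measurable_measure_of) auto
  then show ?thesis
    using measurable_cong_sets[OF sets sets] by (simp add: \<O>_def)
qed

text \<open>Translation by \<open>k\<close> is injective on cosets, so invariance of the image gives
  invariance of membership. This makes the centred indicator of \<open>B\<close> a spherical
  function.\<close>

lemma (in lie_group) spherical_set_coset_iff:
  assumes \<Gamma>: "\<Gamma> \<subseteq> carrier G" and K: "K \<subseteq> carrier G" and B: "B \<subseteq> rcosets \<Gamma>" "spherical_set G K B"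
    and x: "x \<in> rcosets \<Gamma>" and k: "k \<in> K"
  shows "x #> k \<in> B \<longleftrightarrow> x \<in> B"
proof
  have image: "(\<lambda>x. x #> k) ` B = B"
    using B(2) k by (auto simp: spherical_set_def)
  have cancel: "(y #> k) #> inv k = y" if "y \<in> rcosets \<Gamma>" for y
    using that \<Gamma> K k by (auto simp: RCOSETS_def coset_mult_assoc m_assoc subset_eq)
  show "x \<in> B \<Longrightarrow> x #> k \<in> B"
    using image by blast
  assume "x #> k \<in> B"
  then have "x #> k \<in> (\<lambda>x. x #> k) ` B"
    using image by simp
  then obtain y where "y \<in> B" "x #> k = y #> k"
    by (rule imageE) auto
  then show "x \<in> B"
    using cancel x B(1) by (metis subsetD)
qed

section \<open>Covariance decay along the flow and the conclusion\<close>

theorem theorem1p5: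
  fixes G :: "'g monoid"
    and T :: "'g topology"
    and A :: "('g set \<times> ('g \<Rightarrow> 'e::euclidean_space)) set"
    and K \<Gamma> :: "'g set"
    and \<mu> :: "'g set measure"
    and X\<^sub>0 :: "'g vfield"
    and h :: "real \<Rightarrow> 'g"
  assumes "lie_group G T A"
    and "connected_space T"
    and "lie_semisimple (lie_algebra G A)"
    and "finite (group_center G)"
    and "no_compact_factors G T"
    and "maximal_compact_subgroup G T K"
    and "irreducible_lattice G T \<Gamma>"
    and "invariant_prob G T \<Gamma> \<mu>"
    and "X\<^sub>0 \<in> lie_algebra G A"
    and "exp_curve G T A X\<^sub>0 h"
    and "unbounded_in T h"
    and "summable_decay G \<Gamma> K \<mu> h"
  shows "strongly_borel_cantelli \<mu> (\<lambda>m x. x #>\<^bsub>G\<^esub> h (real_of_int m))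
           {B. B \<subseteq> rcosets\<^bsub>G\<^esub> \<Gamma> \<and> spherical_set G K B}"
proof -
  interpret lie_group G T A by fact
  interpret prob_space \<mu>
    using assms(8) by (simp add: invariant_prob_def)
  have \<Gamma>: "\<Gamma> \<subseteq> carrier G"
    using assms(7) by (auto simp: irreducible_lattice_def lattice_in_def subgroup.subset)
  have K: "K \<subseteq> carrier G"
    using assms(6) by (auto simp: maximal_compact_subgroup_def compact_subgroup_def subgroup.subset)
  have sets: "sets \<mu> = sets (sigma (rcosets\<^bsub>G\<^esub> \<Gamma>) {U. openin (coset_topology G T \<Gamma>) U})"
    and inv: "\<And>g. g \<in> carrier G \<Longrightarrow> distr \<mu> \<mu> (\<lambda>x. x #>\<^bsub>G\<^esub> g) = \<mu>"
    using assms(8) by (auto simp: invariant_prob_def)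
  have space: "space \<mu> = rcosets\<^bsub>G\<^esub> \<Gamma>"
    using sets_eq_imp_space_eq[OF sets]
    by (simp add: space_measure_of_conv)
  have h_carrier: "h t \<in> carrier G" for t
    using assms(10) by (auto simp: exp_curve_def continuous_map_def topspace_eq)
  have h_add: "h (s + t) = h s \<otimes>\<^bsub>G\<^esub> h t" for s t
    using assms(10) by (auto simp: exp_curve_def)
  have meas: "(\<lambda>x. x #>\<^bsub>G\<^esub> g) \<in> measurable \<mu> \<mu>" if "g \<in> carrier G" for g
    using measurable_right_translation[OF \<Gamma> that sets] .
  define shift where "shift = (\<lambda>t B. (\<lambda>x. x #>\<^bsub>G\<^esub> h t) -` B \<inter> space \<mu>)"
  have shift_sets: "shift t B \<in> sets \<mu>" if "B \<in> sets \<mu>" for t B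
    unfolding shift_def using meas[OF h_carrier] that by (rule measurable_sets)
  have shift_prob: "prob (shift t B) = prob B" if "B \<in> sets \<mu>" for t B
    unfolding shift_def using measure_distr[OF meas[OF h_carrier] that] inv[OF h_carrier] by simp
  have act: "(x #>\<^bsub>G\<^esub> h s) #>\<^bsub>G\<^esub> h t = x #>\<^bsub>G\<^esub> h (s + t)" if "x \<in> space \<mu>" for x s t
    using that \<Gamma> h_carrier by (auto simp: space RCOSETS_def coset_mult_assoc m_assoc h_add)
  have act_space: "x #>\<^bsub>G\<^esub> h s \<in> space \<mu>" if "x \<in> space \<mu>" for x s
    using measurable_space[OF meas[OF h_carrier] that] .
  obtain \<eta> C where \<eta>: "\<eta> > 1" and C: "C > 0" and decay:
    "\<And>\<phi> \<psi> t. \<phi> \<in> L2_zero \<mu> \<Longrightarrow> \<psi> \<in> L2_zero \<mu> \<Longrightarrow> spherical_fun G \<Gamma> K \<phi> \<Longrightarrow> spherical_fun G \<Gamma> K \<psi> \<Longrightarrow>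
      \<bar>t\<bar> \<ge> 1 \<Longrightarrow> cmod (L2_inner \<mu> (right_regular G (h t) \<phi>) \<psi>)
        \<le> C * L2_norm \<mu> \<phi> * L2_norm \<mu> \<psi> * \<bar>t\<bar> powr (- \<eta>)"
    using assms(12) unfolding summable_decay_def by blast
  \<comment> \<open>The value at 0 is set apart for the diagonal terms: there \<open>powr\<close>
    would give 0, which cannot bound a variance in general.\<close>
  define c where "c = (\<lambda>d::nat. if d = 0 then 1 else C * real d powr (- \<eta>))"
  have c_nonneg: "0 \<le> c d" for d
    using C by (simp add: c_def)
  have "summable (\<lambda>d. C * real d powr (- \<eta>))"
    using \<eta> by (intro summable_mult) (simp add: summable_real_powr_iff)
  moreover have "\<forall>\<^sub>F d in sequentially. C * real d powr (- \<eta>) = c d"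
    using eventually_gt_at_top[of 0] by eventually_elim (simp add: c_def)
  ultimately have c_summable: "summable c"
    using summable_cong by fast
  show ?thesis
    unfolding strongly_borel_cantelli_def
  proof (intro allI impI)
    fix B :: "nat \<Rightarrow> 'g set set"
    assume "\<forall>m\<ge>1. B m \<in> {B. B \<subseteq> rcosets\<^bsub>G\<^esub> \<Gamma> \<and> spherical_set G K B} \<and> B m \<in> sets \<mu>"
    then have B: "B m \<subseteq> rcosets\<^bsub>G\<^esub> \<Gamma>" "spherical_set G K (B m)" "B m \<in> sets \<mu>" if "m \<ge> 1" for m
      using that by auto
    assume inf: "filterlim (\<lambda>m. \<Sum>j=1..m. prob (B j)) at_top sequentially"
    \<comment> \<open>From here on \<open>A\<close> denotes the events and shadows the
      atlas.\<close>
    define A where "A = (\<lambda>j. shift (real j) (B j))"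
    have A: "A j \<in> events" "prob (A j) = prob (B j)" if "j \<ge> 1" for j
      using B(3)[OF that] by (auto simp: A_def shift_sets shift_prob)
    have spherical: "spherical_fun G \<Gamma> K (centred (B j))" if "j \<ge> 1" for j
      using spherical_set_coset_iff[OF \<Gamma> K B(1,2)[OF that]]
      by (auto simp: spherical_fun_def centred_def indicator_def)
    have cov: "prob (A i \<inter> A j) - prob (A i) * prob (A j)
        \<le> c (nat \<bar>int i - int j\<bar>) * (prob (A i) + prob (A j))" if ij: "i \<ge> 1" "j \<ge> 1" for i j
    proof (cases "i = j")
      case True
      \<comment> \<open>With \<open>c 0 = 1\<close> the diagonal bound reads
        \<open>p - p * p \<le> p + p\<close>, where \<open>p\<close> is
        \<open>prob (A j)\<close>.\<close>
      have "- (prob (A j) * prob (A j)) \<le> prob (A j)"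
        by (rule order_trans[of _ 0]) simp_all
      with True show ?thesis
        by (simp add: c_def)
    next
      case False
      \<comment> \<open>A nonzero difference of integers, so \<open>\<bar>t\<bar> \<ge> 1\<close>
        and the decay estimate applies.\<close>
      define t where "t = real i - real j"
      have t: "\<bar>t\<bar> = real (nat \<bar>int i - int j\<bar>)" "1 \<le> \<bar>t\<bar>"
        using False by (auto simp: t_def)
      \<comment> \<open>Moving by \<open>h i\<close> is moving by \<open>h j\<close> and then by
        \<open>h t\<close>. Invariance of the measure then removes the common shift by
        \<open>h j\<close>.\<close>
      have "A i \<inter> A j = shift (real j) (shift t (B i) \<inter> B j)"
        using act[of _ "real j" t] act_space by (auto simp: A_def shift_def t_def)
      then have inter: "prob (A i \<inter> A j) = prob (shift t (B i) \<inter> B j)"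
        using B(3)[OF ij(1)] B(3)[OF ij(2)] by (simp add: shift_prob shift_sets sets.Int)
      \<comment> \<open>Translating a centred indicator shifts its set and keeps the mean, by
        invariance. The shifted set need not be spherical: decay is applied to the original sets
        only.\<close>
      have "L2_inner \<mu> (right_regular G (h t) (centred (B i))) (centred (B j)) =
          L2_inner \<mu> (centred (shift t (B i))) (centred (B j))"
        unfolding L2_inner_def right_regular_def centred_def shift_prob[OF B(3)[OF ij(1)]]
        by (intro Bochner_Integration.integral_cong) (auto simp: indicator_def shift_def)
      also have "\<dots> = of_real (prob (A i \<inter> A j) - prob (A i) * prob (A j))"
        using B(3) ij by (simp add: L2_inner_centred shift_sets shift_prob inter A(2))
      finally have "prob (A i \<inter> A j) - prob (A i) * prob (A j) \<le>
          cmod (L2_inner \<mu> (right_regular G (h t) (centred (B i))) (centred (B j)))"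
        by (simp flip: of_real_mult of_real_diff)
      also have "\<dots> \<le> C * L2_norm \<mu> (centred (B i)) * L2_norm \<mu> (centred (B j)) * \<bar>t\<bar> powr (- \<eta>)"
        using t(2) B(3) spherical ij by (intro decay centred_L2_zero)
      also have "\<dots> \<le> C * sqrt (prob (B i)) * sqrt (prob (B j)) * \<bar>t\<bar> powr (- \<eta>)"
        using C L2_norm_centred_le B(3) ij
        by (intro mult_mono mult_nonneg_nonneg) (auto simp: L2_norm_def)
      also have "\<dots> = c (nat \<bar>int i - int j\<bar>) * (sqrt (prob (B i)) * sqrt (prob (B j)))"
        using t by (simp add: c_def)
      also have "\<dots> \<le> c (nat \<bar>int i - int j\<bar>) * (prob (B i) + prob (B j))"
      proof (intro mult_left_mono c_nonneg)
        \<comment> \<open>The arithmetic-geometric mean inequality gives the additive form that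
          \<open>variance_count_le\<close> takes.\<close>
        have "sqrt (prob (B i)) * sqrt (prob (B j)) \<le> (prob (B i) + prob (B j)) / 2"
          using arith_geo_mean_sqrt[of "prob (B i)" "prob (B j)"] by (simp add: real_sqrt_mult)
        also have "\<dots> \<le> prob (B i) + prob (B j)"
          by simp
        finally show "sqrt (prob (B i)) * sqrt (prob (B j)) \<le> prob (B i) + prob (B j)" .
      qed
      finally show ?thesis
        using A(2) ij by simp
    qed
    have sums: "(\<Sum>j=1..m. prob (A j)) = (\<Sum>j=1..m. prob (B j))" for m
      by (intro sum.cong) (auto simp: A(2))
    have "AE x in \<mu>. (\<lambda>m. (\<Sum>j=1..m. indicator (A j) x) / (\<Sum>j=1..m. prob (A j))) \<longlonglongrightarrow> 1"
    proof (rule AE_count_ratio_tendsto_one[OF A(1)])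
      show "variance (\<lambda>x. \<Sum>j=1..n. indicator (A j) x) \<le> 4 * suminf c * (\<Sum>j=1..n. prob (A j))" for n
        using A(1) c_nonneg c_summable cov by (rule variance_count_le)
      show "filterlim (\<lambda>m. \<Sum>j=1..m. prob (A j)) at_top sequentially"
        unfolding sums by (rule inf)
    qed
    then show "AE x in \<mu>. (\<lambda>m. real (card {j \<in> {1..m}. x #>\<^bsub>G\<^esub> h (real_of_int (int j)) \<in> B j}) /
        (\<Sum>j=1..m. prob (B j))) \<longlonglongrightarrow> 1"
      using AE_space
    proof eventually_elim
      case (elim x)
      \<comment> \<open>Membership in \<open>A j\<close> includes membership in the space, hence the
        use of \<open>AE_space\<close>.\<close>
      have "(\<Sum>j=1..m. indicator (A j) x) = real (card {j \<in> {1..m}. x #>\<^bsub>G\<^esub> h (real_of_int (int j)) \<in> B j})" for m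
        using elim(2) by (simp add: A_def shift_def indicator_def sum.If_cases Int_def)
      with elim(1) show ?case
        by (simp only: sums)
    qed
  qed
qed

end
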